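(* Let $\ell,m,N\in\mathbb N$ with $1\le \ell\le m$, let $\alpha\in\mathbb R$, and let $\rho,\gamma,\tau\in(0,\infty)$. Let $A(\cdot,\cdot)$, $B(\cdot,\cdot)$, $c_{2j}(\cdot,\cdot)$, $\ln_p$, $L_p$, $e_N$ be as in the context. Then the following hold. (i) If $\rho\ge e_N\gamma$, then for all $f\in C_0^\infty((\rho,\infty))$, \begin{align*} \int_\rho^\infty x^\alpha |f^{(m)}(x)|^2dx \ge{}& A(\ell,\alpha)\int_\rho^\infty x^{\alpha-2\ell}|f^{(m-\ell)}(x)|^2dx\\ &+B(\ell,\alpha)\sum_{k=1}^{N}\int_\rho^\infty x^{\alpha-2\ell}\prod_{p=1}^k[\ln_p(x/\gamma)]^{-2}|f^{(m-\ell)}(x)|^2dx\\ &+\sum_{j=2}^{\ell}|c_{2j}(\ell,\alpha)|A(j,0)\int_\rho^\infty x^{\alpha-2\ell}[\ln(x/\gamma)]^{-2j}|f^{(m-\ell)}(x)|^2dx\\ &+\sum_{j=2}^{\ell}|c_{2j}(\ell,\alpha)|B(j,0)\sum_{k=1}^{N-1}\int_\rho^\infty x^{\alpha-2\ell}[\ln(x/\gamma)]^{-2j}\prod_{p=1}^k[\ln_{p+1}(x/\gamma)]^{-2}|f^{(m-\ell)}(x)|^2dx. \end{align*} (ii) If $\rho\ge\tau$, then for all $f\in C_0^\infty((\rho,\infty))$, \begin{align*} \int_\rho^\infty x^\alpha |f^{(m)}(x)|^2dx \ge{}& A(\ell,\alpha)\int_\rho^\infty x^{\alpha-2\ell}|f^{(m-\ell)}(x)|^2dx\\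 &+B(\ell,\alpha)\sum_{k=1}^{N}\int_\rho^\infty x^{\alpha-2\ell}\prod_{p=1}^k[L_p(\tau/x)]^{2}|f^{(m-\ell)}(x)|^2dx\\ &+\sum_{j=2}^{\ell}|c_{2j}(\ell,\alpha)|A(j,0)\int_\rho^\infty x^{\alpha-2\ell}[L_1(\tau/x)]^{2j}|f^{(m-\ell)}(x)|^2dx\\ &+\sum_{j=2}^{\ell}|c_{2j}(\ell,\alpha)|B(j,0)\sum_{k=1}^{N-1}\int_\rho^\infty x^{\alpha-2\ell}[L_1(\tau/x)]^{2j}\prod_{p=1}^k[L_{p+1}(\tau/x)]^{2}|f^{(m-\ell)}(x)|^2dx. \end{align*} (iii) If $\gamma\ge e_N\rho$, then for all $f\in C_0^\infty((0,\rho))$, \begin{align*} \int_0^\rho x^\alpha |f^{(m)}(x)|^2dx \ge{}& A(\ell,\alpha)\int_0^\rho x^{\alpha-2\ell}|f^{(m-\ell)}(x)|^2dx\\ &+B(\ell,\alpha)\sum_{k=1}^{N}\int_0^\rho x^{\alpha-2\ell}\prod_{p=1}^k[\ln_p(\gamma/x)]^{-2}|f^{(m-\ell)}(x)|^2dx\\ &+\sum_{j=2}^{\ell}|c_{2j}(\ell,\alpha)|A(j,0)\int_0^\rho x^{\alpha-2\ell}[\ln(\gamma/x)]^{-2j}|f^{(m-\ell)}(x)|^2dx\\ &+\sum_{j=2}^{\ell}|c_{2j}(\ell,\alpha)|B(j,0)\sum_{k=1}^{N-1}\int_0^\rho x^{\alpha-2\ell}[\ln(\gamma/x)]^{-2j}\prod_{p=1}^k[\ln_{p+1}(\gamma/x)]^{-2}|f^{(m-\ell)}(x)|^2dx.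 \end{align*} (iv) If $\tau\ge\rho$, then for all $f\in C_0^\infty((0,\rho))$, \begin{align*} \int_0^\rho x^\alpha |f^{(m)}(x)|^2dx \ge{}& A(\ell,\alpha)\int_0^\rho x^{\alpha-2\ell}|f^{(m-\ell)}(x)|^2dx\\ &+B(\ell,\alpha)\sum_{k=1}^{N}\int_0^\rho x^{\alpha-2\ell}\prod_{p=1}^k[L_p(x/\tau)]^{2}|f^{(m-\ell)}(x)|^2dx\\ &+\sum_{j=2}^{\ell}|c_{2j}(\ell,\alpha)|A(j,0)\int_0^\rho x^{\alpha-2\ell}[L_1(x/\tau)]^{2j}|f^{(m-\ell)}(x)|^2dx\\ &+\sum_{j=2}^{\ell}|c_{2j}(\ell,\alpha)|B(j,0)\sum_{k=1}^{N-1}\int_0^\rho x^{\alpha-2\ell}[L_1(x/\tau)]^{2j}\prod_{p=1}^k[L_{p+1}(x/\tau)]^{2}|f^{(m-\ell)}(x)|^2dx. \end{align*} (v) Each of the inequalities in (i)--(iv) is strict whenever $f\not\equiv0$ (on $(\rho,\infty)$, respectively $(0,\rho)$). (vi) In the exceptional cases $\alpha\in\{2j-1\}_{1\le j\le \ell}$ (i.e., if and only if $A(\ell,\alpha)=0$), the first terms, containing $A(\ell,\alpha)$, on the right-hand sides are to be deleted (the inequalities hold without them).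
   Context: $\mathbb N=\{1,2,\dots\}$; functions are complex-valued; $C_0^\infty((a,b))$ denotes the smooth functions with compact support in the open interval $(a,b)$. Empty sums ($\sum_{k=1}^{0}$, $\sum_{j=2}^{1}$) are $0$. Iterated logarithms: $\ln_1=\ln$, $\ln_{j+1}(\cdot)=\ln(\ln_j(\cdot))$, $j\in\mathbb N$. Normalized iterated logarithms: $L_1(s)=(1-\ln s)^{-1}$ and $L_{j+1}(s)=L_1(L_j(s))$, $j\in\mathbb N$, for $s\in(0,1]$. Iterated exponentials: $e_0=0$, $e_{j+1}=e^{e_j}$, $j\in\mathbb N\cup\{0\}$ (so $e_1=1$, $e_2=e$). Constants: for $m\in\mathbb N$, $\alpha\in\mathbb R$, $$A(m,\alpha)=\prod_{j=1}^m\Big(\frac{2j-1-\alpha}{2}\Big)^2,\qquad B(m,\alpha)=\frac1{4^m}\sum_{k=1}^m\prod_{\substack{j=1\\ j\ne k}}^m(2j-1-\alpha)^2,$$ and $c_i(m,\alpha)$, $0\le i\le 2m$, are the coefficients of the polynomial $$\sum_{i=0}^{2m}c_i(m,\alpha)\lambda^i=\prod_{j=1}^m\Big(\lambda^2-\frac{(2j-1-\alpha)^2}{4}\Big).$$ *)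

theory Defs
  imports "HOL-Analysis.Analysis" "HOL-Computational_Algebra.Polynomial"
begin

text \<open>The functions \<open>ln\<^sub>j\<close> (\<open>iter_ln\<close>) and \<open>L\<^sub>j\<close> (\<open>norm_ln\<close>) are meant for \<open>j \<ge> 1\<close>; the identity at
  index 0 only starts the recursion.\<close>

primrec iter_ln :: "nat \<Rightarrow> real \<Rightarrow> real" where
  "iter_ln 0 x = x"
| "iter_ln (Suc j) x = ln (iter_ln j x)"

primrec norm_ln :: "nat \<Rightarrow> real \<Rightarrow> real" where
  "norm_ln 0 s = s"
| "norm_ln (Suc j) s = inverse (1 - ln (norm_ln j s))"

primrec iter_exp :: "nat \<Rightarrow> real" where
  "iter_exp 0 = 0"
| "iter_exp (Suc j) = exp (iter_exp j)"

definition A_const :: "nat \<Rightarrow> real \<Rightarrow> real" where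
  "A_const m \<alpha> = (\<Prod>j=1..m. ((2 * real j - 1 - \<alpha>) / 2)\<^sup>2)"

definition B_const :: "nat \<Rightarrow> real \<Rightarrow> real" where
  "B_const m \<alpha> = 1 / 4 ^ m * (\<Sum>k=1..m. \<Prod>j\<in>{1..m} - {k}. (2 * real j - 1 - \<alpha>)\<^sup>2)"

definition c_const :: "nat \<Rightarrow> nat \<Rightarrow> real \<Rightarrow> real" where
  "c_const i m \<alpha> = coeff (\<Prod>j=1..m. [: - ((2 * real j - 1 - \<alpha>)\<^sup>2 / 4), 0, 1 :]) i"

definition nderiv :: "nat \<Rightarrow> (real \<Rightarrow> complex) \<Rightarrow> real \<Rightarrow> complex" where
  "nderiv k f = ((\<lambda>g x. vector_derivative g (at x)) ^^ k) f"

text \<open>The space \<open>C\<^sub>0\<^sup>\<infinity>(I)\<close> for an open interval \<open>I\<close>; its elements are identified with their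
  extensions by zero to the whole real line.\<close>

definition test_functions :: "real set \<Rightarrow> (real \<Rightarrow> complex) set" where
  "test_functions I = {f. (\<forall>k x. nderiv k f differentiable (at x)) \<and>
     compact (closure {x. f x \<noteq> 0}) \<and> closure {x. f x \<noteq> 0} \<subseteq> I}"

text \<open>For a test function, every integrand used below is continuous with compact support in the
  open interval \<open>I\<close>, so the value 0 of non-integrable functions plays no role.\<close>

definition weighted_int :: "real set \<Rightarrow> real \<Rightarrow> (real \<Rightarrow> real) \<Rightarrow> (real \<Rightarrow> complex) \<Rightarrow> real" where
  "weighted_int I \<beta> v g = (LINT x:I|lborel. x powr \<beta> * v x * (cmod (g x))\<^sup>2)"

text \<open>The family \<open>w\<close> is
  \<open>w p x = 1 / ln\<^sub>p (x / \<gamma>)\<close> or \<open>1 / ln\<^sub>p (\<gamma> / x)\<close> for the iterated logarithms, and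
  \<open>w p x = L\<^sub>p (\<tau> / x)\<close> or \<open>L\<^sub>p (x / \<tau>)\<close> for the normalized ones.\<close>

definition log_terms ::
  "real set \<Rightarrow> nat \<Rightarrow> nat \<Rightarrow> real \<Rightarrow> (nat \<Rightarrow> real \<Rightarrow> real) \<Rightarrow> (real \<Rightarrow> complex) \<Rightarrow> real" where
  "log_terms I l N \<alpha> w g =
     B_const l \<alpha> * (\<Sum>k=1..N.
       weighted_int I (\<alpha> - 2 * real l) (\<lambda>x. \<Prod>p=1..k. (w p x)\<^sup>2) g)
   + (\<Sum>j=2..l. \<bar>c_const (2 * j) l \<alpha>\<bar> * A_const j 0 *
       weighted_int I (\<alpha> - 2 * real l) (\<lambda>x. w 1 x ^ (2 * j)) g)
   + (\<Sum>j=2..l. \<bar>c_const (2 * j) l \<alpha>\<bar> * B_const j 0 * (\<Sum>k=1..N - 1.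
       weighted_int I (\<alpha> - 2 * real l) (\<lambda>x. w 1 x ^ (2 * j) * (\<Prod>p=1..k. (w (p + 1) x)\<^sup>2)) g))"

definition hardy_lhs :: "real set \<Rightarrow> nat \<Rightarrow> real \<Rightarrow> (real \<Rightarrow> complex) \<Rightarrow> real" where
  "hardy_lhs I m \<alpha> f = weighted_int I \<alpha> (\<lambda>x. 1) (nderiv m f)"

definition hardy_rhs ::
  "real set \<Rightarrow> nat \<Rightarrow> nat \<Rightarrow> nat \<Rightarrow> real \<Rightarrow> (nat \<Rightarrow> real \<Rightarrow> real) \<Rightarrow> (real \<Rightarrow> complex) \<Rightarrow> real" where
  "hardy_rhs I m l N \<alpha> w f =
     A_const l \<alpha> * weighted_int I (\<alpha> - 2 * real l) (\<lambda>x. 1) (nderiv (m - l) f)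
   + log_terms I l N \<alpha> w (nderiv (m - l) f)"

definition hardy_rhs_exceptional ::
  "real set \<Rightarrow> nat \<Rightarrow> nat \<Rightarrow> nat \<Rightarrow> real \<Rightarrow> (nat \<Rightarrow> real \<Rightarrow> real) \<Rightarrow> (real \<Rightarrow> complex) \<Rightarrow> real" where
  "hardy_rhs_exceptional I m l N \<alpha> w f = log_terms I l N \<alpha> w (nderiv (m - l) f)"

end

(* The substitution x = kappa * exp (sigma * t) with f(x) = x^s phi(t), s = (2 l - 1 - alpha) / 2,
   turns x^l f^(l) into a product of first order operators D + b_j applied to phi, and mixed terms
   integrate to 0, so the left-hand side is the sum over j <= l of |c_{2j}(l, alpha)| times the
   integral of |phi^(j)|^2. The term j = 0 is the A-term; to each term j >= 1 the inequality
   itself is applied with alpha = 0, order j and N - 1 logarithms in the variable t. This is an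
   induction on N, strict because c_{2l} = 1 and a nonzero compactly supported function has no
   vanishing derivative. *)
theory Submission
  imports Defs
begin

text \<open>Each substitution uses up exactly one logarithm: the weight x^(\<alpha> - 2 l) turns
  into dt, and the power t^(-2 j) of the Hardy inequality in t is the first logarithm to the power 2
  j. Of the inner inequality only the A- and B-terms are used, so the induction hypothesis omits the
  sums over j \<ge> 2; it has to hold for all orders at once, since every order from 1 to l occurs.
  The term j = 1 yields the whole B-sum, because |c_2(l, \<alpha>)| = 4 B(l, \<alpha>) and A(1, 0) =
  B(1, 0) = 1/4. The sign of \<sigma> sends both (\<rho>, \<infinity>) and (0, \<rho>) into a
  half-line unbounded to the right, so the induction runs on outer intervals only. For iterated
  logarithms its left end drops from e_N to e_{N-1} at each substitution, which is the origin of the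
  condition with e_N. For the functions L_p an extra factor e in the scale keeps the left end at
  1.\<close>

section \<open>Exponential change of variables in Lebesgue integrals\<close>

text \<open>The change-of-variables theorem is an equivalence, so integrability passes both ways;
  where it fails, both integrals take the default value 0 and still agree. |\<sigma>| = 1 makes the
  Jacobian equal to the new variable x itself.\<close>

lemma lborel_integral_exp_substitution:
  fixes F :: "real \<Rightarrow> real"
  assumes [measurable]: "F \<in> borel_measurable borel" and F0: "\<And>x. x \<le> 0 \<Longrightarrow> F x = 0"
    and \<kappa>: "0 < \<kappa>" and \<sigma>: "\<bar>\<sigma>\<bar> = 1"
  shows "(LINT x|lborel. F x) =
         (LINT t|lborel. \<kappa> * exp (\<sigma> * t) * F (\<kappa> * exp (\<sigma> * t)))"
proof -
  define g where "g t = \<kappa> * exp (\<sigma> * t)" for t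
  define G where "G t = g t * F (g t)" for t
  have [measurable]: "g \<in> borel_measurable borel" "G \<in> borel_measurable borel"
    unfolding G_def g_def by measurable
  have \<sigma>0: "\<sigma> \<noteq> 0" using \<sigma> by auto
  have der: "(g has_field_derivative \<sigma> * g x) (at x within UNIV)" for x
    unfolding g_def by (auto intro!: derivative_eq_intros)
  have inj: "inj g" using \<kappa> \<sigma>0 by (auto simp: inj_def g_def)
  have rng: "range g = {0<..}"
  proof (intro equalityI subsetI)
    fix x :: real assume "x \<in> {0<..}"
    then have "g (ln (x / \<kappa>) / \<sigma>) = x" using \<kappa> \<sigma>0 by (simp add: g_def)
    then show "x \<in> range g" by (metis rangeI)
  qed (use \<kappa> in \<open>auto simp: g_def\<close>)
  have absg: "\<bar>\<sigma> * g x\<bar> * F (g x) = G x" for x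
    using \<kappa> \<sigma> by (simp add: G_def g_def abs_mult)
  have cov: "G absolutely_integrable_on UNIV \<and> integral UNIV G = b
      \<longleftrightarrow> F absolutely_integrable_on {0<..} \<and> integral {0<..} F = b" for b
    using has_absolute_integral_change_of_variables_1'[of UNIV g "\<lambda>x. \<sigma> * g x" F b] der inj
    by (simp add: absg rng)
  have F: "(\<lambda>x. indicator {0<..} x *\<^sub>R F x) = F"
    using F0 by (auto simp: fun_eq_iff indicator_def not_less)
  then have F': "(\<lambda>x. indicator {0<..} x * F x) = F" by simp
  have FI: "F absolutely_integrable_on {0<..} \<longleftrightarrow> integrable lborel F"
    by (simp add: set_integrable_def F' integrable_completion)
  have GI: "G absolutely_integrable_on UNIV \<longleftrightarrow> integrable lborel G"
    by (simp add: set_integrable_def integrable_completion)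
  show ?thesis
  proof (cases "integrable lborel F")
    case True
    then have fi: "F absolutely_integrable_on {0<..}" using FI by simp
    with cov have gi: "G absolutely_integrable_on UNIV" "integral UNIV G = integral {0<..} F"
      by blast+
    have "(LINT x|lborel. F x) = integral {0<..} F"
      using set_lebesgue_integral_eq_integral(2)[OF fi]
      by (simp add: set_lebesgue_integral_def F' integral_completion)
    moreover have "(LINT x|lborel. G x) = integral UNIV G"
      using set_lebesgue_integral_eq_integral(2)[OF gi(1)]
      by (simp add: set_lebesgue_integral_def integral_completion)
    ultimately show ?thesis using gi by (simp add: G_def g_def)
  next
    case False
    then have "\<not> integrable lborel G" using FI GI cov by blast
    then have "integral\<^sup>L lborel G = 0" by (rule not_integrable_integral_eq)
    with False show ?thesis by (simp add: not_integrable_integral_eq G_def[abs_def] g_def)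
  qed
qed

section \<open>Iterated derivatives, smoothness and test functions\<close>

lemma nderiv_0 [simp]: "nderiv 0 f = f"
  by (simp add: nderiv_def)

lemma nderiv_Suc: "nderiv (Suc k) f x = vector_derivative (nderiv k f) (at x)"
  by (simp add: nderiv_def)

lemma nderiv_nderiv: "nderiv j (nderiv k f) = nderiv (j + k) f"
  by (simp add: nderiv_def funpow_add)

definition smooth :: "(real \<Rightarrow> complex) \<Rightarrow> bool" where
  "smooth f \<longleftrightarrow> (\<forall>k x. nderiv k f differentiable (at x))"

lemma smooth_nderiv: "smooth f \<Longrightarrow> smooth (nderiv k f)"
  by (simp add: smooth_def nderiv_nderiv)

lemma smooth_has_vector_derivative:
  "smooth f \<Longrightarrow> (nderiv k f has_vector_derivative nderiv (Suc k) f x) (at x)"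
  by (simp add: smooth_def nderiv_Suc vector_derivative_works)

lemma smooth_continuous: "smooth f \<Longrightarrow> continuous_on S (nderiv k f)"
  by (meson smooth_def continuous_at_imp_continuous_on differentiable_imp_continuous_within)

lemma smooth_measurable: "smooth f \<Longrightarrow> nderiv k f \<in> borel_measurable borel"
  using borel_measurable_continuous_onI smooth_continuous by blast

text \<open>A closed form for all iterated derivatives is avoided: membership in a family closed
  under differentiation is the invariant.\<close>

lemma smoothI:
  assumes S: "\<And>h. h \<in> S \<Longrightarrow> \<exists>h'\<in>S. \<forall>x. (h has_vector_derivative h' x) (at x)"
    and "f \<in> S"
  shows "smooth f"
proof -
  have *: "nderiv k f \<in> S" for k
  proof (induction k)
    case (Suc k)
    from S[OF Suc] obtain h' where "h' \<in> S" "\<And>x. (nderiv k f has_vector_derivative h' x) (at x)"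
      by blast
    moreover from this have "nderiv (Suc k) f = h'"
      by (auto simp: nderiv_Suc fun_eq_iff vector_derivative_at)
    ultimately show ?case by simp
  qed (use assms in simp)
  show ?thesis unfolding smooth_def
    using S[OF *] by (meson differentiableI_vector)
qed

lemma nderiv_linear:
  assumes f: "smooth f" and g: "smooth g"
  shows "nderiv k (\<lambda>x. a *\<^sub>R f x + b *\<^sub>R g x) = (\<lambda>x. a *\<^sub>R nderiv k f x + b *\<^sub>R nderiv k g x)"
proof (induction k)
  case (Suc k)
  show ?case
    unfolding fun_eq_iff nderiv_Suc[of k "\<lambda>x. a *\<^sub>R f x + b *\<^sub>R g x"] Suc
    by (intro allI vector_derivative_at)
       (auto intro!: derivative_eq_intros smooth_has_vector_derivative f g)
qed simp

text \<open>The complement of the support is open, so vanishing there is a local property and is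
  inherited by the derivative.\<close>

lemma nderiv_eq_0_outside:
  assumes "x \<notin> closure {x. f x \<noteq> 0}"
  shows "nderiv k f x = 0"
  using assms
proof (induction k arbitrary: x)
  case 0
  then show ?case using closure_subset by force
next
  case (Suc k)
  let ?U = "- closure {x. f x \<noteq> 0}"
  have "(nderiv k f has_vector_derivative 0) (at x)"
    by (rule has_vector_derivative_transform_within_open[of "\<lambda>_. 0" _ _ ?U])
       (use Suc in \<open>auto simp: has_vector_derivative_const\<close>)
  then show ?case by (simp add: nderiv_Suc vector_derivative_at)
qed

lemma test_functions_smooth: "f \<in> test_functions I \<Longrightarrow> smooth f"
  by (simp add: test_functions_def smooth_def)

lemma test_functions_eq_0: "f \<in> test_functions I \<Longrightarrow> x \<notin> I \<Longrightarrow> nderiv k f x = 0"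
  by (rule nderiv_eq_0_outside) (auto simp: test_functions_def)

lemma test_functionsI:
  assumes "smooth f" "compact K" "K \<subseteq> I" "\<And>x. x \<notin> K \<Longrightarrow> f x = 0"
  shows "f \<in> test_functions I"
proof -
  have "closure {x. f x \<noteq> 0} \<subseteq> K"
    using assms by (intro closure_minimal) (auto simp: compact_imp_closed)
  moreover from this have "compact (closure {x. f x \<noteq> 0})"
    using assms(2) compact_Int_closed[of K "closure {x. f x \<noteq> 0}"] by (simp add: Int_absorb1)
  ultimately show ?thesis using assms by (auto simp: test_functions_def smooth_def)
qed

lemma nderiv_test_functions:
  assumes "f \<in> test_functions I"
  shows "nderiv k f \<in> test_functions I"
proof (rule test_functionsI[of _ "closure {x. f x \<noteq> 0}"])
  show "smooth (nderiv k f)" using assms by (intro smooth_nderiv test_functions_smooth)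
qed (use assms nderiv_eq_0_outside in \<open>auto simp: test_functions_def\<close>)

lemma test_function_integrable:
  assumes "f \<in> test_functions I" and c: "continuous_on UNIV F"
    and F0: "\<And>x. f x = 0 \<Longrightarrow> F x = (0::real)"
  shows "integrable lborel F"
proof -
  let ?K = "closure {x. f x \<noteq> 0}"
  have "integrable lborel (\<lambda>x. indicator ?K x *\<^sub>R F x)"
    using assms(1) c
    by (intro borel_integrable_compact) (auto simp: test_functions_def intro: continuous_on_subset)
  moreover have "(\<lambda>x. indicator ?K x *\<^sub>R F x) = F"
    using F0 closure_subset[of "{x. f x \<noteq> 0}"] by (auto simp: fun_eq_iff indicator_def)
  ultimately show ?thesis by simp
qed

text \<open>If a derivative vanished identically, the preceding one would be constant; the support
  is bounded, so some point lies outside it and forces the constant to be 0.\<close>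

lemma nderiv_test_function_nonzero:
  assumes f: "f \<in> test_functions I" and "f x \<noteq> 0"
  shows "\<exists>y. nderiv k f y \<noteq> 0"
proof (induction k)
  case 0
  then show ?case using assms by auto
next
  case (Suc k)
  then obtain y where y: "nderiv k f y \<noteq> 0" by blast
  show ?case
  proof (rule ccontr)
    assume "\<nexists>y. nderiv (Suc k) f y \<noteq> 0"
    then have "(nderiv k f has_vector_derivative 0) (at x)" for x
      using smooth_has_vector_derivative[OF test_functions_smooth[OF f], of k x] by simp
    then obtain c where c: "\<And>x. nderiv k f x = c"
      using has_vector_derivative_zero_constant[of UNIV "nderiv k f"] by auto
    have "bounded {x. f x \<noteq> 0}"
      using f bounded_subset[OF compact_imp_bounded closure_subset] by (auto simp: test_functions_def)
    moreover have "\<not> bounded (UNIV :: real set)" by simp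
    ultimately obtain z where "z \<notin> closure {x. f x \<noteq> 0}"
      by (metis UNIV_eq_I bounded_closure)
    then have "c = 0" using c nderiv_eq_0_outside by metis
    with y c show False by simp
  qed
qed

section \<open>Squared L2 norms of test functions\<close>

definition energy :: "(real \<Rightarrow> complex) \<Rightarrow> real" where
  "energy h = (LINT t|lborel. (cmod (h t))\<^sup>2)"

lemma energy_nonneg: "0 \<le> energy h"
  by (simp add: energy_def)

lemma energy_pos:
  assumes h: "h \<in> test_functions I" and "h x \<noteq> 0"
  shows "0 < energy h"
proof -
  have cont: "continuous_on UNIV h"
    using smooth_continuous[of h UNIV 0] test_functions_smooth[OF h] by simp
  have int: "integrable lborel (\<lambda>t. (cmod (h t))\<^sup>2)"
    by (rule test_function_integrable[OF h]) (auto intro!: continuous_intros cont)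
  have "energy h \<noteq> 0"
  proof
    assume "energy h = 0"
    then have ae: "AE t in lborel. (cmod (h t))\<^sup>2 = 0"
      unfolding energy_def by (subst (asm) integral_nonneg_eq_0_iff_AE[OF int]) auto
    then have ae: "AE t in lborel. t \<in> {t. h t = 0}" by simp
    \<comment> \<open>A closed set of full measure is the whole line, so h would vanish at x
      too.\<close>
    have "closed {t. h t = 0}" using cont by (intro closed_Collect_eq) auto
    from mem_closed_if_AE_lebesgue_open[OF _ this, of UNIV x] ae assms(2) show False
      by (auto simp: AE_completion)
  qed
  then show ?thesis using energy_nonneg[of h] by linarith
qed

text \<open>On complex values \<open>\<bullet>\<close> is the real part of h times the conjugate of
  h', which is half the derivative of |h|^2. The fundamental theorem on an interval [-r, r] around
  the support leaves only boundary values, and these are 0.\<close>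

lemma test_function_mult_deriv_integral:
  assumes h: "h \<in> test_functions I"
  shows "(LINT t|lborel. h t \<bullet> nderiv 1 h t) = 0"
    and "integrable lborel (\<lambda>t. h t \<bullet> nderiv 1 h t)"
proof -
  have s: "smooth h" using h by (rule test_functions_smooth)
  have cont: "continuous_on UNIV h" "continuous_on UNIV (nderiv 1 h)"
    using smooth_continuous[OF s, of UNIV 0] smooth_continuous[OF s, of UNIV 1] by simp_all
  show int: "integrable lborel (\<lambda>t. h t \<bullet> nderiv 1 h t)"
    by (rule test_function_integrable[OF h]; (intro continuous_intros cont)?) simp
  have "bounded (closure {x. h x \<noteq> 0})" using h
    by (auto simp: test_functions_def compact_imp_bounded)
  then obtain r where r: "0 < r" "closure {x. h x \<noteq> 0} \<subseteq> ball 0 r"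
    using bounded_subset_ballD by blast
  then have out: "h t = 0" if "\<bar>t\<bar> \<ge> r" for t
    using that closure_subset[of "{x. h x \<noteq> 0}"] by (auto simp: subset_iff) 
  have der: "((\<lambda>t. (h t \<bullet> h t) / 2) has_vector_derivative h t \<bullet> nderiv 1 h t) (at t within A)" for t A
  proof -
    have "(h has_derivative (\<lambda>x. x *\<^sub>R nderiv 1 h t)) (at t within A)"
      using smooth_has_vector_derivative[OF s, of 0 t]
      by (auto simp: has_vector_derivative_def intro: has_derivative_at_withinI)
    from has_derivative_inner[OF this this]
    have "((\<lambda>t. (h t \<bullet> h t)) has_vector_derivative 2 * (h t \<bullet> nderiv 1 h t)) (at t within A)"
      by (simp add: has_vector_derivative_def inner_commute algebra_simps)
    from has_vector_derivative_mult_right[OF this, of "1/2"] show ?thesis by simp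
  qed
  have "((\<lambda>t. h t \<bullet> nderiv 1 h t) has_integral (h r \<bullet> h r) / 2 - (h (-r) \<bullet> h (-r)) / 2) {-r..r}"
    using der r by (intro fundamental_theorem_of_calculus) auto
  then have "((\<lambda>t. h t \<bullet> nderiv 1 h t) has_integral 0) {-r..r}"
    using out r by simp
  then have "((\<lambda>t. h t \<bullet> nderiv 1 h t) has_integral 0) UNIV"
    by (rule has_integral_on_superset) (use out in auto)
  with has_integral_integral_lborel[OF int] show "(LINT t|lborel. h t \<bullet> nderiv 1 h t) = 0"
    by (rule has_integral_unique)
qed

text \<open>The mixed term is the integral of the derivative of \<open>b \<sigma> \<bar>h\<bar>\<^sup>2\<close> and vanishes.\<close>
lemma energy_first_order:
  assumes h: "h \<in> test_functions I" and "\<bar>\<sigma>\<bar> = 1"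
  shows "energy (\<lambda>t. \<sigma> *\<^sub>R nderiv 1 h t + b *\<^sub>R h t) = energy (nderiv 1 h) + b\<^sup>2 * energy h"
proof -
  have s: "smooth h" using h by (rule test_functions_smooth)
  have cont: "continuous_on UNIV h" "continuous_on UNIV (nderiv 1 h)"
    using smooth_continuous[OF s, of UNIV 0] smooth_continuous[OF s, of UNIV 1] by simp_all
  have i1: "integrable lborel (\<lambda>t. (cmod (h t))\<^sup>2)"
    by (rule test_function_integrable[OF h]) (auto intro!: continuous_intros cont)
  have i2: "integrable lborel (\<lambda>t. (cmod (nderiv 1 h t))\<^sup>2)"
    by (rule test_function_integrable[OF nderiv_test_functions[OF h, of 1]])
       (intro continuous_intros cont, simp)
  have i3: "integrable lborel (\<lambda>t. h t \<bullet> nderiv 1 h t)"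
    by (rule test_function_mult_deriv_integral[OF h])
  have \<sigma>: "\<sigma> * \<sigma> = 1" using assms(2) by (metis abs_mult_self_eq mult_1)
  have "(cmod (\<sigma> *\<^sub>R nderiv 1 h t + b *\<^sub>R h t))\<^sup>2 =
      (cmod (nderiv 1 h t))\<^sup>2 + b\<^sup>2 * (cmod (h t))\<^sup>2 + 2 * \<sigma> * b * (h t \<bullet> nderiv 1 h t)" for t
    using \<sigma> unfolding power2_norm_eq_inner
    by (simp add: inner_simps inner_commute power2_eq_square)
  then show ?thesis
    unfolding energy_def using i1 i2 i3 test_function_mult_deriv_integral(1)[OF h] by simp
qed

section \<open>The substituted function and its energy expansion\<close>

text \<open>Index 0 is the function phi of the substitution; index l is the function whose squared
  norm is the left-hand side. Treating all k as one family, x^(k - s) f^(k)(x), gives a two-term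
  recursion for the derivative.\<close>

definition exp_subst ::
  "real \<Rightarrow> real \<Rightarrow> real \<Rightarrow> (real \<Rightarrow> complex) \<Rightarrow> nat \<Rightarrow> real \<Rightarrow> complex" where
  "exp_subst \<kappa> \<sigma> s f k t =
     ((\<kappa> * exp (\<sigma> * t)) powr (real k - s)) *\<^sub>R nderiv k f (\<kappa> * exp (\<sigma> * t))"

text \<open>The differentiation-closed family handed to \<open>smoothI\<close>; binary combinations
  suffice because the derivative of \<open>exp_subst\<close> at k involves only k and k + 1.\<close>

inductive_set linear_hull :: "(nat \<Rightarrow> real \<Rightarrow> complex) \<Rightarrow> (real \<Rightarrow> complex) set"
  for G where
  base: "G k \<in> linear_hull G"
| comb: "g \<in> linear_hull G \<Longrightarrow> h \<in> linear_hull G \<Longrightarrow> (\<lambda>t. a *\<^sub>R g t + b *\<^sub>R h t) \<in> linear_hull G"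

text \<open>Since dx/dt = \<sigma> x, the inner derivative supplies the factor x: it restores the
  exponent lowered by differentiating the power, and raises the exponent next to f^(k+1) to the one
  belonging to index k + 1.\<close>

lemma exp_subst_has_vector_derivative:
  assumes f: "smooth f" and \<kappa>: "0 < \<kappa>"
  shows "(exp_subst \<kappa> \<sigma> s f k has_vector_derivative
           (\<sigma> * (real k - s)) *\<^sub>R exp_subst \<kappa> \<sigma> s f k t + \<sigma> *\<^sub>R exp_subst \<kappa> \<sigma> s f (Suc k) t) (at t)"
proof -
  let ?x = "\<lambda>t. \<kappa> * exp (\<sigma> * t)"
  have x0: "?x t > 0" for t using \<kappa> by simp
  have x: "(?x has_real_derivative \<sigma> * ?x t) (at t)"
    by (auto intro!: derivative_eq_intros)
  have p: "((\<lambda>t. ?x t powr (real k - s)) has_real_derivative \<sigma> * (real k - s) * ?x t powr (real k - s)) (at t)"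
  proof (rule DERIV_cong[OF DERIV_chain2[OF has_real_derivative_powr[OF x0] x]])
    have "?x t * ?x t powr (real k - s - 1) = ?x t powr (real k - s)"
      using powr_mult_base[of "?x t" "real k - s - 1"] x0[of t] by simp
    then show "(real k - s) * ?x t powr (real k - s - 1) * (\<sigma> * ?x t) =
        \<sigma> * (real k - s) * ?x t powr (real k - s)"
      by (metis mult.assoc mult.commute)
  qed
  have "((nderiv k f \<circ> ?x) has_vector_derivative (\<sigma> * ?x t) *\<^sub>R nderiv (Suc k) f (?x t)) (at t)"
    by (intro vector_diff_chain_at smooth_has_vector_derivative f)
       (use x in \<open>simp add: has_real_derivative_iff_has_vector_derivative\<close>)
  then have d: "((\<lambda>t. nderiv k f (?x t)) has_vector_derivative (\<sigma> * ?x t) *\<^sub>R nderiv (Suc k) f (?x t)) (at t)"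
    by (simp add: o_def)
  have e: "?x t powr (real (Suc k) - s) = ?x t * ?x t powr (real k - s)"
  proof -
    have "real (Suc k) - s = 1 + (real k - s)" by simp
    then show ?thesis
      using powr_mult_base[of "?x t" "real k - s"] x0[of t] by (simp only: less_imp_le)
  qed
  show ?thesis unfolding exp_subst_def[abs_def] e
    using has_vector_derivative_scaleR[OF p d] by (simp add: algebra_simps)
qed

lemma smooth_exp_subst:
  assumes f: "smooth f" and \<kappa>: "0 < \<kappa>"
  shows "smooth (exp_subst \<kappa> \<sigma> s f k)"
proof (rule smoothI)
  let ?S = "linear_hull (exp_subst \<kappa> \<sigma> s f)"
  show "exp_subst \<kappa> \<sigma> s f k \<in> ?S" by (rule linear_hull.base)
  fix h assume "h \<in> ?S"
  then show "\<exists>h'\<in>?S. \<forall>x. (h has_vector_derivative h' x) (at x)"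
  proof induction
    case (base k)
    show ?case
      using exp_subst_has_vector_derivative[OF assms]
      by (intro bexI[OF _ linear_hull.comb[OF linear_hull.base linear_hull.base]]) blast
  next
    case (comb g h a b)
    then obtain g' h' where "g' \<in> ?S" "h' \<in> ?S"
      "\<forall>x. (g has_vector_derivative g' x) (at x)" "\<forall>x. (h has_vector_derivative h' x) (at x)"
      by blast
    then show ?case
      by (intro bexI[OF _ linear_hull.comb[of g' _ h' a b]])
         (auto intro!: derivative_eq_intros)
  qed
qed

text \<open>Because \<sigma>^2 = 1, the map x \<mapsto> \<sigma> ln (x / \<kappa>) inverts the
  substitution, and the continuous image of the support of f is a compact set outside which the new
  function vanishes.\<close>

lemma exp_subst_test_function:
  assumes f: "f \<in> test_functions I" and \<kappa>: "0 < \<kappa>" and \<sigma>: "\<bar>\<sigma>\<bar> = 1"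
    and I: "I \<subseteq> {0<..}" and J: "\<And>x. x \<in> I \<Longrightarrow> \<sigma> * ln (x / \<kappa>) \<in> J"
  shows "exp_subst \<kappa> \<sigma> s f k \<in> test_functions J"
proof (rule test_functionsI)
  let ?K = "closure {x. f x \<noteq> 0}"
  let ?T = "\<lambda>x. \<sigma> * ln (x / \<kappa>)"
  have K: "compact ?K" "?K \<subseteq> I" using f by (auto simp: test_functions_def)
  show "smooth (exp_subst \<kappa> \<sigma> s f k)"
    using smooth_exp_subst test_functions_smooth f \<kappa> by blast
  show "compact (?T ` ?K)"
    using K I \<kappa> by (intro compact_continuous_image continuous_intros) (auto dest!: subsetD)
  show "?T ` ?K \<subseteq> J" using K J by auto
  fix t assume t: "t \<notin> ?T ` ?K"
  have "\<sigma> * \<sigma> = 1" using \<sigma> by (metis abs_mult_self_eq mult_1)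
  then have "?T (\<kappa> * exp (\<sigma> * t)) = t" using \<kappa> by (simp add: mult.assoc[symmetric])
  then have "\<kappa> * exp (\<sigma> * t) \<notin> ?K" using t by (metis imageI)
  then show "exp_subst \<kappa> \<sigma> s f k t = 0"
    by (simp add: exp_subst_def nderiv_eq_0_outside)
qed

text \<open>The derivative formula solved for index k + 1 by means of \<sigma>^2 = 1. This is the
  first-order factor with b = s - k; its coefficients are constant, so it commutes with further
  derivatives.\<close>

lemma nderiv_exp_subst_Suc:
  assumes f: "smooth f" and \<kappa>: "0 < \<kappa>" and \<sigma>: "\<bar>\<sigma>\<bar> = 1"
  shows "nderiv j (exp_subst \<kappa> \<sigma> s f (Suc k)) =
    (\<lambda>t. \<sigma> *\<^sub>R nderiv (Suc j) (exp_subst \<kappa> \<sigma> s f k) t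
       + (s - real k) *\<^sub>R nderiv j (exp_subst \<kappa> \<sigma> s f k) t)"
proof -
  let ?G = "exp_subst \<kappa> \<sigma> s f"
  have \<sigma>\<sigma>: "\<sigma> * \<sigma> = 1" using \<sigma> by (metis abs_mult_self_eq mult_1)
  have "?G (Suc k) t = \<sigma> *\<^sub>R nderiv 1 (?G k) t + (s - real k) *\<^sub>R ?G k t" for t
  proof -
    have "nderiv (Suc 0) (?G k) t = (\<sigma> * (real k - s)) *\<^sub>R ?G k t + \<sigma> *\<^sub>R ?G (Suc k) t"
      using vector_derivative_at[OF exp_subst_has_vector_derivative[OF f \<kappa>]]
      by (simp add: nderiv_Suc)
    then have "nderiv 1 (?G k) t = (\<sigma> * (real k - s)) *\<^sub>R ?G k t + \<sigma> *\<^sub>R ?G (Suc k) t"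
      by simp
    then have "\<sigma> *\<^sub>R nderiv 1 (?G k) t =
        (\<sigma> * \<sigma> * (real k - s)) *\<^sub>R ?G k t + (\<sigma> * \<sigma>) *\<^sub>R ?G (Suc k) t"
      by (simp only: scaleR_add_right scaleR_scaleR mult.assoc)
    then show ?thesis by (simp add: \<sigma>\<sigma> algebra_simps)
  qed
  then have "?G (Suc k) = (\<lambda>t. \<sigma> *\<^sub>R nderiv 1 (?G k) t + (s - real k) *\<^sub>R ?G k t)" by blast
  then show ?thesis
    using nderiv_linear[OF smooth_nderiv[OF smooth_exp_subst[OF f \<kappa>], of 1] smooth_exp_subst[OF f \<kappa>]]
    by (simp add: nderiv_nderiv)
qed

text \<open>Each first-order factor acts on energies like multiplication by \<lambda> + (s - k)^2,
  where \<lambda> raises the order of the derivative by one. This shift is why j is arbitrary in the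
  induction.\<close>

lemma energy_exp_subst:
  assumes f: "f \<in> test_functions I" and \<kappa>: "0 < \<kappa>" and \<sigma>: "\<bar>\<sigma>\<bar> = 1" and I: "I \<subseteq> {0<..}"
  shows "energy (nderiv j (exp_subst \<kappa> \<sigma> s f n)) =
    (\<Sum>i\<le>n. coeff (\<Prod>k<n. [:(s - real k)\<^sup>2, 1:]) i * energy (nderiv (i + j) (exp_subst \<kappa> \<sigma> s f 0)))"
proof (induction n arbitrary: j)
  case (Suc n)
  let ?G = "exp_subst \<kappa> \<sigma> s f" and ?p = "\<Prod>k<n. [:(s - real k)\<^sup>2, 1:]"
  let ?E = "\<lambda>i. energy (nderiv i (?G 0))"
  have test: "nderiv j (?G n) \<in> test_functions UNIV"
    by (intro nderiv_test_functions exp_subst_test_function[OF f \<kappa> \<sigma> I]) simp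
  have "energy (nderiv j (?G (Suc n))) =
      energy (nderiv (Suc j) (?G n)) + (s - real n)\<^sup>2 * energy (nderiv j (?G n))"
    using energy_first_order[OF test \<sigma>]
    by (simp add: nderiv_exp_subst_Suc[OF test_functions_smooth[OF f] \<kappa> \<sigma>] nderiv_nderiv)
  also have "\<dots> = (\<Sum>i\<le>n. coeff ?p i * ?E (Suc i + j)) + (\<Sum>i\<le>n. (s - real n)\<^sup>2 * coeff ?p i * ?E (i + j))"
    by (simp only: Suc) (simp add: sum_distrib_left mult.assoc)
  also have "(\<Sum>i\<le>n. (s - real n)\<^sup>2 * coeff ?p i * ?E (i + j)) =
      (\<Sum>i\<le>Suc n. (s - real n)\<^sup>2 * coeff ?p i * ?E (i + j))"
  proof -
    \<comment> \<open>The extra summand at Suc n is 0, as the polynomial has degree at most n; both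
      sums then have the same range.\<close>
    have "degree ?p \<le> (\<Sum>k<n. degree [:(s - real k)\<^sup>2, 1:])"
      by (rule order.trans[OF degree_prod_sum_le]) auto
    then have "coeff ?p (Suc n) = 0" by (intro coeff_eq_0) simp
    then show ?thesis by simp
  qed
  also have "(\<Sum>i\<le>n. coeff ?p i * ?E (Suc i + j)) =
      (\<Sum>i\<le>Suc n. (case i of 0 \<Rightarrow> 0 | Suc i \<Rightarrow> coeff ?p i) * ?E (i + j))"
    by (subst sum.atMost_Suc_shift) simp
  finally show ?case
    by (simp only: sum.distrib[symmetric])
       (rule sum.cong, auto simp: coeff_pCons algebra_simps split: nat.split)
qed simp

section \<open>Weighted integrals in the variable t\<close>

lemma weighted_int_lborel:
  assumes "\<And>x. x \<notin> I \<Longrightarrow> g x = 0"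
  shows "weighted_int I \<beta> v g = (LINT x|lborel. x powr \<beta> * v x * (cmod (g x))\<^sup>2)"
  unfolding weighted_int_def set_lebesgue_integral_def
  by (rule Bochner_Integration.integral_cong) (use assms in \<open>auto simp: indicator_def\<close>)

lemma weighted_int_nonneg:
  assumes "\<And>x. x \<in> I \<Longrightarrow> 0 \<le> v x"
  shows "0 \<le> weighted_int I \<beta> v g"
  unfolding weighted_int_def set_lebesgue_integral_def
  by (rule Bochner_Integration.integral_nonneg) (use assms in \<open>auto simp: indicator_def\<close>)

text \<open>The exponent \<open>s = (2 l - 1 - \<alpha>) / 2\<close> is the one for which \<open>x\<^sup>\<alpha> dx\<close> becomes \<open>dt\<close>.\<close>
lemma weighted_int_exp_subst:
  assumes f: "f \<in> test_functions I" and \<kappa>: "0 < \<kappa>" and \<sigma>: "\<bar>\<sigma>\<bar> = 1" and I: "I \<subseteq> {0<..}"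
    and v [measurable]: "v \<in> borel_measurable borel"
  shows "weighted_int I (2 * real k - 2 * s - 1) v (nderiv k f) =
    (LINT t|lborel. v (\<kappa> * exp (\<sigma> * t)) * (cmod (exp_subst \<kappa> \<sigma> s f k t))\<^sup>2)"
proof -
  let ?F = "\<lambda>x. x powr (2 * real k - 2 * s - 1) * v x * (cmod (nderiv k f x))\<^sup>2"
  note [measurable] = smooth_measurable[OF test_functions_smooth[OF f], of k]
  have out: "nderiv k f x = 0" if "x \<notin> I" for x
    using f that by (rule test_functions_eq_0)
  then have neg: "nderiv k f x = 0" if "x \<le> 0" for x
    using that I by (metis greaterThan_iff not_less subsetD)
  have "weighted_int I (2 * real k - 2 * s - 1) v (nderiv k f) = (LINT x|lborel. ?F x)"
    by (rule weighted_int_lborel) (rule out)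
  also have "\<dots> = (LINT t|lborel. \<kappa> * exp (\<sigma> * t) * ?F (\<kappa> * exp (\<sigma> * t)))"
    by (rule lborel_integral_exp_substitution) (use neg \<kappa> \<sigma> in auto)
  also have "\<dots> = (LINT t|lborel. v (\<kappa> * exp (\<sigma> * t)) * (cmod (exp_subst \<kappa> \<sigma> s f k t))\<^sup>2)"
  proof (rule Bochner_Integration.integral_cong)
    fix t
    let ?x = "\<kappa> * exp (\<sigma> * t)"
    have "?x > 0" using \<kappa> by simp
    moreover from this have "(?x powr (real k - s))\<^sup>2 = ?x powr (2 * (real k - s))"
      by (simp add: power2_eq_square powr_add[symmetric])
    ultimately have "?x * ?x powr (2 * real k - 2 * s - 1) = (?x powr (real k - s))\<^sup>2"
      using powr_add[of ?x 1 "2 * real k - 2 * s - 1"] by (simp add: algebra_simps)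
    then show "?x * ?F ?x = v ?x * (cmod (exp_subst \<kappa> \<sigma> s f k t))\<^sup>2"
      by (simp add: exp_subst_def power_mult_distrib mult.assoc[symmetric])
  qed simp
  finally show ?thesis .
qed

section \<open>The polynomial behind the constants A, B and c\<close>

text \<open>Up to the sign (-1)^l, this is the polynomial defining the \<open>c_const\<close> with
  \<lambda>^2 replaced by -\<lambda>. The replacement makes all coefficients nonnegative, hence
  equal to the absolute values |c_{2j}|.\<close>

definition hardy_poly :: "nat \<Rightarrow> real \<Rightarrow> real poly" where
  "hardy_poly l \<alpha> = (\<Prod>j=1..l. [:((2 * real j - 1 - \<alpha>) / 2)\<^sup>2, 1:])"

lemma hardy_poly_0 [simp]: "hardy_poly 0 \<alpha> = 1"
  by (simp add: hardy_poly_def)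

lemma coeff_hardy_poly_Suc:
  "coeff (hardy_poly (Suc l) \<alpha>) j =
     ((2 * real (Suc l) - 1 - \<alpha>) / 2)\<^sup>2 * coeff (hardy_poly l \<alpha>) j
     + (case j of 0 \<Rightarrow> 0 | Suc i \<Rightarrow> coeff (hardy_poly l \<alpha>) i)"
  by (simp add: hardy_poly_def mult.commute[of _ "[:_, 1:]"] coeff_pCons split: nat.split)

text \<open>The shifts s - k for k < l, with s = (2 l - 1 - \<alpha>) / 2, are the numbers (2 j - 1
  - \<alpha>) / 2 in reverse order, j = l - k.\<close>

lemma hardy_poly_altdef:
  "hardy_poly l \<alpha> = (\<Prod>k<l. [:((2 * real l - 1 - \<alpha>) / 2 - real k)\<^sup>2, 1:])"
proof -
  have "hardy_poly l \<alpha> = (\<Prod>k<l. [:((2 * real (Suc k) - 1 - \<alpha>) / 2)\<^sup>2, 1:])"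
    unfolding hardy_poly_def by (simp add: prod.atLeast1_atMost_eq)
  also have "\<dots> = (\<Prod>k<l. [:((2 * real (Suc (l - Suc k)) - 1 - \<alpha>) / 2)\<^sup>2, 1:])"
    by (rule prod.nat_diff_reindex[symmetric])
  also have "\<dots> = (\<Prod>k<l. [:((2 * real l - 1 - \<alpha>) / 2 - real k)\<^sup>2, 1:])"
  proof (rule prod.cong)
    fix k assume "k \<in> {..<l}"
    then have "real (Suc (l - Suc k)) = real l - real k" by (simp add: of_nat_diff)
    then show "[:((2 * real (Suc (l - Suc k)) - 1 - \<alpha>) / 2)\<^sup>2, 1:] =
        [:((2 * real l - 1 - \<alpha>) / 2 - real k)\<^sup>2, 1:]"
      by (simp add: field_simps)
  qed simp
  finally show ?thesis .
qed

lemma coeff_hardy_poly_nonneg: "0 \<le> coeff (hardy_poly l \<alpha>) j"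
proof (induction l arbitrary: j)
  case (Suc l)
  then show ?case by (auto simp: coeff_hardy_poly_Suc split: nat.split)
qed (simp add: coeff_1)

lemma coeff_hardy_poly_eq_0: "l < j \<Longrightarrow> coeff (hardy_poly l \<alpha>) j = 0"
  by (induction l arbitrary: j) (auto simp: coeff_hardy_poly_Suc coeff_1 split: nat.split)

lemma coeff_hardy_poly_top: "coeff (hardy_poly l \<alpha>) l = 1"
  by (induction l) (auto simp: coeff_hardy_poly_Suc coeff_hardy_poly_eq_0)

lemma coeff_0_hardy_poly: "coeff (hardy_poly l \<alpha>) 0 = A_const l \<alpha>"
  by (simp add: hardy_poly_def A_const_def poly_prod flip: poly_0_coeff_0)

text \<open>The linear coefficient is the derivative at 0, and the product rule omits one factor.
  The remaining l - 1 factors carry 4^(l - 1), whereas \<open>B_const\<close> divides by 4^l; hence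
  the 4.\<close>

lemma coeff_1_hardy_poly: "coeff (hardy_poly l \<alpha>) 1 = 4 * B_const l \<alpha>"
proof -
  have "coeff (hardy_poly l \<alpha>) 1 = poly (pderiv (hardy_poly l \<alpha>)) 0"
    by (simp add: poly_0_coeff_0 coeff_pderiv)
  also have "\<dots> = (\<Sum>k=1..l. \<Prod>j\<in>{1..l} - {k}. ((2 * real j - 1 - \<alpha>) / 2)\<^sup>2)"
    by (simp add: hardy_poly_def pderiv_prod pderiv_pCons poly_sum poly_prod)
  also have "\<dots> = (\<Sum>k=1..l. 4 / 4 ^ l * (\<Prod>j\<in>{1..l} - {k}. (2 * real j - 1 - \<alpha>)\<^sup>2))"
  proof (rule sum.cong)
    fix k assume k: "k \<in> {1..l}"
    have "(\<Prod>j\<in>{1..l} - {k}. ((2 * real j - 1 - \<alpha>) / 2)\<^sup>2) =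
        (\<Prod>j\<in>{1..l} - {k}. (2 * real j - 1 - \<alpha>)\<^sup>2) / 4 ^ (l - 1)"
      using k by (simp add: power_divide prod_dividef)
    also have "\<dots> = 4 / 4 ^ l * (\<Prod>j\<in>{1..l} - {k}. (2 * real j - 1 - \<alpha>)\<^sup>2)"
      using k by (cases l) auto
    finally show "(\<Prod>j\<in>{1..l} - {k}. ((2 * real j - 1 - \<alpha>) / 2)\<^sup>2) =
        4 / 4 ^ l * (\<Prod>j\<in>{1..l} - {k}. (2 * real j - 1 - \<alpha>)\<^sup>2)" .
  qed simp
  also have "\<dots> = 4 * B_const l \<alpha>"
    by (simp add: B_const_def sum_distrib_left)
  finally show ?thesis .
qed

text \<open>In the coefficient of \<lambda>^(2j), l - j factors contribute their negative constant
  term, and l - j has the parity of l + j.\<close>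

lemma c_const_eq: "c_const (2 * j) l \<alpha> = (- 1) ^ (l + j) * coeff (hardy_poly l \<alpha>) j"
proof (induction l arbitrary: j)
  case 0
  then show ?case by (cases j) (auto simp: c_const_def coeff_1)
next
  case (Suc l)
  have *: "c_const (2 * j) (Suc l) \<alpha> =
      - ((2 * real (Suc l) - 1 - \<alpha>) / 2)\<^sup>2 * c_const (2 * j) l \<alpha>
      + (case j of 0 \<Rightarrow> 0 | Suc i \<Rightarrow> c_const (2 * i) l \<alpha>)"
    by (cases j)
       (simp_all add: c_const_def mult.commute[of _ "[:_, _, _:]"] coeff_pCons power_divide)
  show ?case
    unfolding * coeff_hardy_poly_Suc
    by (cases j) (simp_all only: Suc nat.case, simp_all add: algebra_simps)
qed

lemma abs_c_const: "\<bar>c_const (2 * j) l \<alpha>\<bar> = coeff (hardy_poly l \<alpha>) j"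
  using coeff_hardy_poly_nonneg[of l \<alpha> j] by (simp add: c_const_eq abs_mult power_abs)

lemma B_const_nonneg: "0 \<le> B_const l \<alpha>"
  by (simp add: B_const_def sum_nonneg prod_nonneg)

lemma A_const_nonneg: "0 \<le> A_const l \<alpha>"
  by (simp add: A_const_def prod_nonneg)

section \<open>The induction step on the number of logarithms\<close>

lemma hardy_lhs_eq_energy:
  assumes f: "f \<in> test_functions I" and \<kappa>: "0 < \<kappa>" and \<sigma>: "\<bar>\<sigma>\<bar> = 1" and I: "I \<subseteq> {0<..}"
    and s: "s = (2 * real l - 1 - \<alpha>) / 2"
  shows "hardy_lhs I l \<alpha> f =
    (\<Sum>j\<le>l. coeff (hardy_poly l \<alpha>) j * energy (nderiv j (exp_subst \<kappa> \<sigma> s f 0)))"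
proof -
  have "\<alpha> = 2 * real l - 2 * s - 1" by (simp add: s field_simps)
  then have "hardy_lhs I l \<alpha> f = energy (exp_subst \<kappa> \<sigma> s f l)"
    using weighted_int_exp_subst[OF f \<kappa> \<sigma> I, of "\<lambda>_. 1" l s]
    by (simp add: hardy_lhs_def energy_def)
  also have "\<dots> = (\<Sum>j\<le>l. coeff (hardy_poly l \<alpha>) j * energy (nderiv j (exp_subst \<kappa> \<sigma> s f 0)))"
    using energy_exp_subst[OF f \<kappa> \<sigma> I, of 0 s l] by (simp add: hardy_poly_altdef s)
  finally show ?thesis .
qed

text \<open>The induction hypothesis: \<alpha> = 0, only the A- and B-terms, strict, and uniform in
  the order l. The parameter a is the left end of the half-line in t, u the family of weights
  there.\<close>

definition log_hardy :: "real \<Rightarrow> nat \<Rightarrow> (nat \<Rightarrow> real \<Rightarrow> real) \<Rightarrow> bool" where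
  "log_hardy a N u \<longleftrightarrow> (\<forall>l\<ge>1. \<forall>f\<in>test_functions {a<..}. (\<exists>x. f x \<noteq> 0) \<longrightarrow>
     A_const l 0 * weighted_int {a<..} (0 - 2 * real l) (\<lambda>x. 1) f
     + B_const l 0 * (\<Sum>k=1..N. weighted_int {a<..} (0 - 2 * real l) (\<lambda>x. \<Prod>p=1..k. (u p x)\<^sup>2) f)
     < hardy_lhs {a<..} l 0 f)"

lemma exp_subst_nonzero:
  assumes "f x \<noteq> 0" "0 < x" "0 < \<kappa>" "\<bar>\<sigma>\<bar> = 1"
  shows "exp_subst \<kappa> \<sigma> s f 0 (\<sigma> * ln (x / \<kappa>)) \<noteq> 0"
proof -
  have "\<sigma> * \<sigma> = 1" using assms by (metis abs_mult_self_eq mult_1)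
  then have "\<kappa> * exp (\<sigma> * (\<sigma> * ln (x / \<kappa>))) = x"
    using assms by (simp add: mult.assoc[symmetric])
  then show ?thesis using assms by (simp add: exp_subst_def)
qed

text \<open>Two terms of the energy expansion suffice: j = 0 is the A-term, and j = l is strictly
  positive because its coefficient is 1.\<close>

lemma log_hardy_0:
  assumes a: "0 \<le> a"
  shows "log_hardy a 0 u"
  unfolding log_hardy_def
proof (intro allI impI ballI)
  fix l :: nat and f assume l: "1 \<le> l" and f: "f \<in> test_functions {a<..}" and "\<exists>x. f x \<noteq> 0"
  then obtain x where x: "f x \<noteq> 0" by blast
  have x0: "x > 0" using x f a test_functions_eq_0[OF f, of x 0] by force
  have I: "{a<..} \<subseteq> {0::real<..}" using a by auto
  define s where "s = (2 * real l - 1 - 0) / 2"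
  let ?\<phi> = "exp_subst 1 1 s f 0"
  have \<phi>: "?\<phi> \<in> test_functions UNIV"
    by (rule exp_subst_test_function[OF f _ _ I]) auto
  from nderiv_test_function_nonzero[OF \<phi> exp_subst_nonzero[of f x 1 1 s]] x x0
  obtain y where "nderiv l ?\<phi> y \<noteq> 0" by auto
  then have pos: "0 < energy (nderiv l ?\<phi>)"
    using energy_pos nderiv_test_functions[OF \<phi>] by blast
  let ?c = "\<lambda>j. coeff (hardy_poly l 0) j * energy (nderiv j ?\<phi>)"
  have "weighted_int {a<..} (0 - 2 * real l) (\<lambda>x. 1) f = energy ?\<phi>"
  proof -
    have "0 - 2 * real l = 2 * real 0 - 2 * s - 1" by (simp add: s_def field_simps)
    then show ?thesis
      using weighted_int_exp_subst[OF f _ _ I, of 1 1 "\<lambda>_. 1" 0 s] by (simp add: energy_def)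
  qed
  then have "A_const l 0 * weighted_int {a<..} (0 - 2 * real l) (\<lambda>x. 1) f = ?c 0"
    by (simp add: coeff_0_hardy_poly)
  also have "\<dots> < ?c 0 + ?c l"
    using pos by (simp add: coeff_hardy_poly_top)
  also have "\<dots> = (\<Sum>j\<in>{0, l}. ?c j)" using l by simp
  also have "\<dots> \<le> (\<Sum>j\<le>l. ?c j)"
    by (rule sum_mono2) (auto intro: mult_nonneg_nonneg coeff_hardy_poly_nonneg energy_nonneg)
  also have "\<dots> = hardy_lhs {a<..} l 0 f"
    using hardy_lhs_eq_energy[OF f _ _ I s_def, of 1 1] by simp
  finally show "A_const l 0 * weighted_int {a<..} (0 - 2 * real l) (\<lambda>x. 1) f
     + B_const l 0 * (\<Sum>k=1..0. weighted_int {a<..} (0 - 2 * real l) (\<lambda>x. \<Prod>p=1..k. (u p x)\<^sup>2) f)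
     < hardy_lhs {a<..} l 0 f" by simp
qed

lemma A_const_1_0: "A_const 1 0 = 1/4"
  by (simp add: A_const_def power_divide)

lemma B_const_1_0: "B_const 1 0 = 1/4"
  by (simp add: B_const_def)

text \<open>The B-sum is the missing summand j = 1: its coefficient is 4 B(l, \<alpha>), cancelled
  by A(1, 0) = B(1, 0) = 1/4, and splitting off p = 1 from a product of k + 1 weights leaves k
  shifted ones. So Suc N logarithms become N.\<close>

lemma log_terms_eq_sum:
  assumes "1 \<le> l"
  shows "log_terms I l (Suc N) \<alpha> w g =
    (\<Sum>j=1..l. coeff (hardy_poly l \<alpha>) j *
      (A_const j 0 * weighted_int I (\<alpha> - 2 * real l) (\<lambda>x. w 1 x ^ (2 * j)) g
       + B_const j 0 * (\<Sum>k=1..N.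
           weighted_int I (\<alpha> - 2 * real l) (\<lambda>x. w 1 x ^ (2 * j) * (\<Prod>p=1..k. (w (p + 1) x)\<^sup>2)) g)))"
    (is "_ = (\<Sum>j=1..l. ?t j)")
proof -
  let ?W = "\<lambda>v. weighted_int I (\<alpha> - 2 * real l) v g"
  have prod: "(\<Prod>p=1..Suc k. (w p x)\<^sup>2) = w 1 x ^ (2 * 1) * (\<Prod>p=1..k. (w (p + 1) x)\<^sup>2)" for k x
    by (simp add: prod.atLeast_Suc_atMost prod.shift_bounds_cl_Suc_ivl del: prod.cl_ivl_Suc)
  have "(\<Sum>k=1..Suc N. ?W (\<lambda>x. \<Prod>p=1..k. (w p x)\<^sup>2)) =
      ?W (\<lambda>x. \<Prod>p=1..1. (w p x)\<^sup>2) + (\<Sum>k=1..N. ?W (\<lambda>x. \<Prod>p=1..Suc k. (w p x)\<^sup>2))"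
    using sum.shift_bounds_cl_Suc_ivl[of "\<lambda>k. ?W (\<lambda>x. \<Prod>p=1..k. (w p x)\<^sup>2)" 1 N]
    by (subst sum.atLeast_Suc_atMost) (simp_all del: prod.cl_ivl_Suc sum.cl_ivl_Suc)
  then have "B_const l \<alpha> * (\<Sum>k=1..Suc N. ?W (\<lambda>x. \<Prod>p=1..k. (w p x)\<^sup>2)) = ?t 1"
    unfolding prod coeff_1_hardy_poly A_const_1_0 B_const_1_0
    by (simp add: algebra_simps power2_eq_square)
  then have "log_terms I l (Suc N) \<alpha> w g = ?t 1 + (\<Sum>j=2..l. ?t j)"
    unfolding log_terms_def abs_c_const
    by (simp add: distrib_left sum.distrib mult.assoc)
  also have "\<dots> = (\<Sum>j=1..l. ?t j)"
    using assms by (subst (2) sum.atLeast_Suc_atMost) (simp_all add: numeral_2_eq_2)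
  finally show ?thesis .
qed

text \<open>Common to all four cases. In t = \<sigma> ln (x / \<kappa>) the first weight is 1/t and
  the weight of index p + 1 is \<open>u p\<close> at t, so \<open>log_hardy\<close> for phi pulls
  back to the required terms.\<close>

lemma hardy_strict_step:
  assumes f: "f \<in> test_functions I" and x: "f x \<noteq> 0" and l: "1 \<le> l"
    and \<kappa>: "0 < \<kappa>" and \<sigma>: "\<bar>\<sigma>\<bar> = 1" and I: "I \<subseteq> {0<..}"
    and a: "0 \<le> a" and T: "\<And>x. x \<in> I \<Longrightarrow> a < \<sigma> * ln (x / \<kappa>)"
    and u: "log_hardy a N u"
    and w [measurable]: "\<And>p. w p \<in> borel_measurable borel"
    and w1: "\<And>x. x \<in> I \<Longrightarrow> w 1 x = inverse (\<sigma> * ln (x / \<kappa>))"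
    and wS: "\<And>x p. x \<in> I \<Longrightarrow> 1 \<le> p \<Longrightarrow> w (Suc p) x = u p (\<sigma> * ln (x / \<kappa>))"
  shows "hardy_rhs I l l (Suc N) \<alpha> w f < hardy_lhs I l \<alpha> f"
proof -
  define s where "s = (2 * real l - 1 - \<alpha>) / 2"
  define \<phi> where "\<phi> = exp_subst \<kappa> \<sigma> s f 0"
  let ?T = "\<lambda>x. \<sigma> * ln (x / \<kappa>)" and ?X = "\<lambda>t. \<kappa> * exp (\<sigma> * t)"
  let ?c = "coeff (hardy_poly l \<alpha>)"
  let ?W = "\<lambda>v. weighted_int I (\<alpha> - 2 * real l) v f"
  have \<sigma>\<sigma>: "\<sigma> * \<sigma> = 1" using \<sigma> by (metis abs_mult_self_eq mult_1)
  have TX: "?T (?X t) = t" for t using \<kappa> \<sigma>\<sigma> by (simp add: mult.assoc[symmetric])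
  have \<phi>: "\<phi> \<in> test_functions {a<..}"
    unfolding \<phi>_def using T by (intro exp_subst_test_function[OF f \<kappa> \<sigma> I]) auto
  have \<phi>0: "\<phi> t = 0" if "?X t \<notin> I" for t
    using test_functions_eq_0[OF f that, of 0] by (simp add: \<phi>_def exp_subst_def)
  have nz: "\<exists>t. \<phi> t \<noteq> 0"
  proof -
    have "x \<in> I" using x test_functions_eq_0[OF f, of x 0] by auto
    then show ?thesis using exp_subst_nonzero[of f x \<kappa> \<sigma> s] x \<kappa> \<sigma> I unfolding \<phi>_def by blast
  qed
  have W: "?W v = (LINT t|lborel. v (?X t) * (cmod (\<phi> t))\<^sup>2)" if "v \<in> borel_measurable borel" for v
  proof -
    have "\<alpha> - 2 * real l = 2 * real 0 - 2 * s - 1" by (simp add: s_def field_simps)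
    then show ?thesis
      using weighted_int_exp_subst[OF f \<kappa> \<sigma> I that, of 0 s] by (simp add: \<phi>_def)
  qed
  \<comment> \<open>Agreement of the weights on I is enough, since phi vanishes at every t whose x
    lies outside I.\<close>
  have transfer: "?W v = weighted_int {a<..} \<beta> v' \<phi>"
    if v: "v \<in> borel_measurable borel" and eq: "\<And>x. x \<in> I \<Longrightarrow> v x = ?T x powr \<beta> * v' (?T x)" for v v' \<beta>
  proof -
    have "weighted_int {a<..} \<beta> v' \<phi> = (LINT t|lborel. t powr \<beta> * v' t * (cmod (\<phi> t))\<^sup>2)"
      using test_functions_eq_0[OF \<phi>, of _ 0] by (intro weighted_int_lborel) auto
    also have "\<dots> = ?W v"
      unfolding W[OF v]
    proof (rule Bochner_Integration.integral_cong)
      fix t show "t powr \<beta> * v' t * (cmod (\<phi> t))\<^sup>2 = v (?X t) * (cmod (\<phi> t))\<^sup>2"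
        using eq[of "?X t"] \<phi>0[of t] unfolding TX by (cases "?X t \<in> I") auto
    qed simp
    finally show ?thesis by simp
  qed
  have pow: "w 1 x ^ (2 * j) = ?T x powr (0 - 2 * real j)" if "x \<in> I" for x j
  proof -
    have "0 < ?T x" using T[OF that] a by linarith
    then show ?thesis
      using powr_realpow[of "?T x" "2 * j"] unfolding w1[OF that]
      by (simp add: powr_minus power_inverse del: inverse_mult_distrib)
  qed
  have en: "energy (nderiv j \<phi>) = hardy_lhs {a<..} j 0 \<phi>" for j
  proof -
    have "hardy_lhs {a<..} j 0 \<phi> = (LINT t|lborel. t powr 0 * 1 * (cmod (nderiv j \<phi> t))\<^sup>2)"
      unfolding hardy_lhs_def using test_functions_eq_0[OF \<phi>, of _ j] by (intro weighted_int_lborel) auto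
    \<comment> \<open>\<open>t powr 0\<close> is 1 except at t = 0, where it is 0; there phi and its
      derivatives vanish because a \<ge> 0.\<close>
    also have "\<dots> = energy (nderiv j \<phi>)"
      unfolding energy_def
      using test_functions_eq_0[OF \<phi>, of 0 j] a by (intro Bochner_Integration.integral_cong) auto
    finally show ?thesis by simp
  qed
  have less: "A_const j 0 * ?W (\<lambda>x. w 1 x ^ (2 * j))
       + B_const j 0 * (\<Sum>k=1..N. ?W (\<lambda>x. w 1 x ^ (2 * j) * (\<Prod>p=1..k. (w (p + 1) x)\<^sup>2)))
     < energy (nderiv j \<phi>)" (is "?t j < _") if "1 \<le> j" for j
  proof -
    have "?W (\<lambda>x. w 1 x ^ (2 * j)) = weighted_int {a<..} (0 - 2 * real j) (\<lambda>x. 1) \<phi>"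
      by (rule transfer) (use pow in auto)
    moreover have "?W (\<lambda>x. w 1 x ^ (2 * j) * (\<Prod>p=1..k. (w (p + 1) x)\<^sup>2)) =
        weighted_int {a<..} (0 - 2 * real j) (\<lambda>x. \<Prod>p=1..k. (u p x)\<^sup>2) \<phi>" for k
    proof (rule transfer)
      fix x assume x: "x \<in> I"
      have "(\<Prod>p=1..k. (w (p + 1) x)\<^sup>2) = (\<Prod>p=1..k. (u p (?T x))\<^sup>2)"
        by (rule prod.cong) (use wS[OF x] in auto)
      then show "w 1 x ^ (2 * j) * (\<Prod>p=1..k. (w (p + 1) x)\<^sup>2) =
          ?T x powr (0 - 2 * real j) * (\<Prod>p=1..k. (u p (?T x))\<^sup>2)"
        by (simp only: pow[OF x])
    qed simp
    ultimately show ?thesis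
      using u \<phi> nz that unfolding log_hardy_def en by simp
  qed
  have "?W (\<lambda>x. 1) = energy \<phi>"
    using W[of "\<lambda>_. 1"] by (simp add: energy_def)
  then have "hardy_rhs I l l (Suc N) \<alpha> w f = ?c 0 * energy \<phi> + (\<Sum>j=1..l. ?c j * ?t j)"
    using l by (simp add: hardy_rhs_def log_terms_eq_sum coeff_0_hardy_poly)
  also have "\<dots> < ?c 0 * energy \<phi> + (\<Sum>j=1..l. ?c j * energy (nderiv j \<phi>))"
  proof -
    have "(\<Sum>j=1..l. ?c j * ?t j) < (\<Sum>j=1..l. ?c j * energy (nderiv j \<phi>))"
    proof (rule sum_strict_mono_ex1)
      show "\<forall>j\<in>{1..l}. ?c j * ?t j \<le> ?c j * energy (nderiv j \<phi>)"
        using less by (intro ballI mult_left_mono coeff_hardy_poly_nonneg less_imp_le) simp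
      \<comment> \<open>At j = l the coefficient is 1, so strictness survives the
        multiplication.\<close>
      show "\<exists>j\<in>{1..l}. ?c j * ?t j < ?c j * energy (nderiv j \<phi>)"
        using less[OF l] l by (intro bexI[of _ l]) (simp_all add: coeff_hardy_poly_top)
    qed simp
    then show ?thesis by simp
  qed
  also have "\<dots> = (\<Sum>j\<le>l. ?c j * energy (nderiv j \<phi>))"
    by (simp add: sum.atMost_shift sum.atLeast1_atMost_eq atMost_atLeast0 sum.atLeast_Suc_atMost)
  also have "\<dots> = hardy_lhs I l \<alpha> f"
    unfolding \<phi>_def by (rule hardy_lhs_eq_energy[OF f \<kappa> \<sigma> I s_def, symmetric])
  finally show ?thesis .
qed

text \<open>Closes the induction: the sums over j \<ge> 2 are nonnegative and may be dropped to
  recover the weaker form.\<close>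

lemma log_hardy_of_hardy_rhs:
  assumes "\<And>l f x. 1 \<le> l \<Longrightarrow> f \<in> test_functions {a<..} \<Longrightarrow> f x \<noteq> 0 \<Longrightarrow>
      hardy_rhs {a<..} l l N 0 w f < hardy_lhs {a<..} l 0 f"
  shows "log_hardy a N w"
  unfolding log_hardy_def
proof (intro allI impI ballI)
  fix l :: nat and f assume l: "1 \<le> l" and f: "f \<in> test_functions {a<..}" and "\<exists>x. f x \<noteq> 0"
  then obtain x where x: "f x \<noteq> 0" by blast
  let ?W = "\<lambda>v. weighted_int {a<..} (0 - 2 * real l) v f"
  have "0 \<le> (\<Sum>j=2..l. \<bar>c_const (2 * j) l 0\<bar> * A_const j 0 * ?W (\<lambda>x. w 1 x ^ (2 * j)))"
    by (intro sum_nonneg mult_nonneg_nonneg abs_ge_zero A_const_nonneg weighted_int_nonneg)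
       (simp add: power_mult)
  moreover have "0 \<le> (\<Sum>j=2..l. \<bar>c_const (2 * j) l 0\<bar> * B_const j 0 * (\<Sum>k=1..N - 1.
       ?W (\<lambda>x. w 1 x ^ (2 * j) * (\<Prod>p=1..k. (w (p + 1) x)\<^sup>2))))"
    by (intro sum_nonneg mult_nonneg_nonneg abs_ge_zero B_const_nonneg weighted_int_nonneg)
       (simp_all add: power_mult prod_nonneg)
  ultimately show "A_const l 0 * ?W (\<lambda>x. 1)
     + B_const l 0 * (\<Sum>k=1..N. ?W (\<lambda>x. \<Prod>p=1..k. (w p x)\<^sup>2)) < hardy_lhs {a<..} l 0 f"
    using assms[OF l f x] by (simp add: hardy_rhs_def log_terms_def)
qed

text \<open>The inequality of order l is applied to the derivative of order m - l, which is a
  nonzero test function whenever f is. For f = 0 both sides are 0, which settles the non-strict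
  claim.\<close>

lemma hardy_reduce:
  assumes "l \<le> m"
    and step: "\<And>f x. f \<in> test_functions I \<Longrightarrow> f x \<noteq> 0 \<Longrightarrow>
      hardy_rhs I l l N \<alpha> w f < hardy_lhs I l \<alpha> f"
  shows "(\<forall>f\<in>test_functions I. hardy_rhs I m l N \<alpha> w f \<le> hardy_lhs I m \<alpha> f) \<and>
    (\<forall>f\<in>test_functions I. (\<exists>x\<in>I. f x \<noteq> 0) \<longrightarrow> hardy_rhs I m l N \<alpha> w f < hardy_lhs I m \<alpha> f)"
proof (intro conjI ballI impI)
  fix f assume f: "f \<in> test_functions I"
  let ?g = "nderiv (m - l) f"
  have L: "hardy_lhs I l \<alpha> ?g = hardy_lhs I m \<alpha> f"
    using assms by (simp add: hardy_lhs_def nderiv_nderiv)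
  have R: "hardy_rhs I l l N \<alpha> w ?g = hardy_rhs I m l N \<alpha> w f"
    by (simp add: hardy_rhs_def)
  show 1: "hardy_rhs I m l N \<alpha> w f < hardy_lhs I m \<alpha> f" if "\<exists>x\<in>I. f x \<noteq> 0"
    using that nderiv_test_function_nonzero[OF f] step[OF nderiv_test_functions[OF f]]
    unfolding L[symmetric] R[symmetric] by blast
  show "hardy_rhs I m l N \<alpha> w f \<le> hardy_lhs I m \<alpha> f"
  proof (cases "\<exists>x\<in>I. f x \<noteq> 0")
    case False
    then have "{x. f x \<noteq> 0} = {}" using test_functions_eq_0[OF f, of _ 0] by auto
    then have "nderiv k f = (\<lambda>x. 0)" for k
      by (intro ext nderiv_eq_0_outside) simp
    then show ?thesis
      by (simp add: hardy_lhs_def hardy_rhs_def log_terms_def weighted_int_def)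
  qed (use 1 in force)
qed

lemma A_const_eq_0_iff: "(\<exists>j\<in>{1..l}. \<alpha> = 2 * real j - 1) \<longleftrightarrow> A_const l \<alpha> = 0"
  by (auto simp: A_const_def)

lemma hardy_rhs_exceptional_eq:
  "A_const l \<alpha> = 0 \<Longrightarrow> hardy_rhs_exceptional I m l N \<alpha> w f = hardy_rhs I m l N \<alpha> w f"
  by (simp add: hardy_rhs_def hardy_rhs_exceptional_def)

section \<open>The four choices of interval and weight\<close>

text \<open>The recursion adds logarithms on the outside, but the substitution removes the innermost
  one.\<close>

lemma iter_ln_Suc': "iter_ln (Suc p) x = iter_ln p (ln x)"
  by (induction p) simp_all

lemma norm_ln_Suc': "norm_ln (Suc p) s = norm_ln p (inverse (1 - ln s))"
  by (induction p) simp_all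

lemma iter_exp_nonneg: "0 \<le> iter_exp N"
  by (cases N) simp_all

lemma iter_ln_measurable [measurable]: "iter_ln p \<in> borel_measurable borel"
  by (induction p) (simp_all add: iter_ln.simps[abs_def])

lemma norm_ln_measurable [measurable]: "norm_ln p \<in> borel_measurable borel"
  by (induction p) (simp_all add: norm_ln.simps[abs_def])

text \<open>Here t = ln (x / \<gamma>), and the bound e_{N+1} \<gamma> \<le> \<rho> yields t > e_N
  on the interval, the half-line of the hypothesis.\<close>

lemma hardy_strict_log_outer:
  assumes u: "log_hardy (iter_exp N) N (\<lambda>p x. inverse (iter_ln p x))"
    and "0 < \<gamma>" "iter_exp (Suc N) * \<gamma> \<le> \<rho>" "1 \<le> l" "f \<in> test_functions {\<rho><..}" "f x \<noteq> 0"
  shows "hardy_rhs {\<rho><..} l l (Suc N) \<alpha> (\<lambda>p x. inverse (iter_ln p (x / \<gamma>))) f < hardy_lhs {\<rho><..} l \<alpha> f"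
proof -
  have T: "0 < y \<and> iter_exp N < 1 * ln (y / \<gamma>)" if "y \<in> {\<rho><..}" for y
  proof -
    have "exp (iter_exp N) < y / \<gamma>" using that assms by (simp add: field_simps)
    moreover from this have "0 < y / \<gamma>" using exp_gt_zero order.strict_trans by blast
    ultimately show ?thesis
      using ln_less_cancel_iff[of "exp (iter_exp N)" "y / \<gamma>"] \<open>0 < \<gamma>\<close>
      by (simp add: zero_less_divide_iff)
  qed
  have pos: "0 \<le> \<rho>" using assms(2,3) order.trans[of 0 "iter_exp (Suc N) * \<gamma>" \<rho>] by simp
  show ?thesis
    by (rule hardy_strict_step[OF assms(5,6,4,2) _ _ iter_exp_nonneg _ u, where \<sigma> = 1])
       (use T pos in \<open>auto simp: iter_ln_Suc' simp del: iter_ln.simps(2)\<close>)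
qed

text \<open>With t = 1 - ln (\<tau> / x) one has \<open>L_1\<close> = 1/t, hence the argument 1/x in
  the hypothesis; \<tau> \<le> \<rho> gives t > 1, whatever N is.\<close>

lemma hardy_strict_norm_outer:
  assumes u: "log_hardy 1 N (\<lambda>p x. norm_ln p (1 / x))"
    and "0 < \<tau>" "\<tau> \<le> \<rho>" "1 \<le> l" "f \<in> test_functions {\<rho><..}" "f x \<noteq> 0"
  shows "hardy_rhs {\<rho><..} l l (Suc N) \<alpha> (\<lambda>p x. norm_ln p (\<tau> / x)) f < hardy_lhs {\<rho><..} l \<alpha> f"
proof -
  \<comment> \<open>\<open>L\<^sub>1 (\<tau> / x) = 1 / ln (e x / \<tau>)\<close>, hence the scale \<open>\<tau> / e\<close>.\<close>
  let ?\<kappa> = "exp (- 1) * \<tau>"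
  have T: "0 < y \<and> ln (\<tau> / y) < 0 \<and> 1 * ln (y / ?\<kappa>) = 1 - ln (\<tau> / y)" if "y \<in> {\<rho><..}" for y
    using that assms by (auto simp: ln_div ln_mult)
  show ?thesis
    by (rule hardy_strict_step[OF assms(5,6,4) _ _ _ _ _ u, where \<sigma> = 1 and \<kappa> = ?\<kappa>])
       (use T assms(2,3) in \<open>auto simp: norm_ln_Suc' inverse_eq_divide simp del: norm_ln.simps(2)\<close>)
qed

text \<open>With \<gamma> = 1 and \<rho> = e_{N+1} the outer case reproduces its own hypothesis; e_0
  = 0 starts the induction on (0, \<infinity>).\<close>

lemma log_hardy_iter_ln: "log_hardy (iter_exp N) N (\<lambda>p x. inverse (iter_ln p x))"
proof (induction N)
  case 0
  show ?case by (rule log_hardy_0) simp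
next
  case (Suc N)
  show ?case
    by (rule log_hardy_of_hardy_rhs) (use hardy_strict_log_outer[OF Suc, of 1] in simp)
qed

lemma log_hardy_norm_ln: "log_hardy 1 N (\<lambda>p x. norm_ln p (1 / x))"
proof (induction N)
  case 0
  show ?case by (rule log_hardy_0) simp
next
  case (Suc N)
  show ?case
    by (rule log_hardy_of_hardy_rhs) (use hardy_strict_norm_outer[OF Suc, of 1 1] in simp)
qed

text \<open>The reflection \<sigma> = -1 gives t = ln (\<gamma> / x), so points near 0 go to large t
  and the outer result already proved applies.\<close>

lemma hardy_strict_log_inner:
  assumes "0 < \<gamma>" "0 < \<rho>" "iter_exp (Suc N) * \<rho> \<le> \<gamma>" "1 \<le> l"
    and "f \<in> test_functions {0<..<\<rho>}" "f x \<noteq> 0"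
  shows "hardy_rhs {0<..<\<rho>} l l (Suc N) \<alpha> (\<lambda>p x. inverse (iter_ln p (\<gamma> / x))) f < hardy_lhs {0<..<\<rho>} l \<alpha> f"
proof -
  have T: "iter_exp N < ln (\<gamma> / y) \<and> - 1 * ln (y / \<gamma>) = ln (\<gamma> / y)"
    if y: "y \<in> {0<..<\<rho>}" for y
  proof -
    have "exp (iter_exp N) * y < exp (iter_exp N) * \<rho>" using y by simp
    with assms(3) have "exp (iter_exp N) * y < \<gamma>" unfolding iter_exp.simps by linarith
    then have "exp (iter_exp N) < \<gamma> / y" using y by (simp add: field_simps)
    then show ?thesis
      using ln_less_cancel_iff[of "exp (iter_exp N)" "\<gamma> / y"] y assms(1) by (simp add: ln_div)
  qed
  show ?thesis
    by (rule hardy_strict_step[OF assms(5,6,4,1) _ _ iter_exp_nonneg _ log_hardy_iter_ln[of N],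
          where \<sigma> = "- 1"])
       (use T in \<open>auto simp: iter_ln_Suc' simp del: iter_ln.simps(2)\<close>)
qed

lemma hardy_strict_norm_inner:
  assumes "0 < \<rho>" "\<rho> \<le> \<tau>" "1 \<le> l" "f \<in> test_functions {0<..<\<rho>}" "f x \<noteq> 0"
  shows "hardy_rhs {0<..<\<rho>} l l (Suc N) \<alpha> (\<lambda>p x. norm_ln p (x / \<tau>)) f < hardy_lhs {0<..<\<rho>} l \<alpha> f"
proof -
  \<comment> \<open>With \<sigma> = -1 the factor e makes t equal to 1 - ln (x / \<tau>), the
    reciprocal of \<open>norm_ln 1 (x / \<tau>)\<close>.\<close>
  let ?\<kappa> = "exp 1 * \<tau>"
  have T: "ln (y / \<tau>) < 0 \<and> - 1 * ln (y / ?\<kappa>) = 1 - ln (y / \<tau>)" if "y \<in> {0<..<\<rho>}" for y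
    using that assms by (auto simp: ln_div ln_mult)
  show ?thesis
    by (rule hardy_strict_step[OF assms(4,5,3) _ _ _ _ _ log_hardy_norm_ln[of N],
          where \<sigma> = "- 1" and \<kappa> = ?\<kappa>])
       (use T assms(1,2) in \<open>auto simp: norm_ln_Suc' inverse_eq_divide simp del: norm_ln.simps(2)\<close>)
qed

theorem theorem3p1:
  fixes l m N :: nat and \<alpha> \<rho> \<gamma> \<tau> :: real
  assumes "1 \<le> l" and "l \<le> m" and "1 \<le> N"
    and "0 < \<rho>" and "0 < \<gamma>" and "0 < \<tau>"
  shows "
    (iter_exp N * \<gamma> \<le> \<rho> \<longrightarrow> (\<forall>f\<in>test_functions {\<rho><..}.
       hardy_lhs {\<rho><..} m \<alpha> f \<ge>
       hardy_rhs {\<rho><..} m l N \<alpha> (\<lambda>p x. inverse (iter_ln p (x / \<gamma>))) f)) \<and>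
    (\<tau> \<le> \<rho> \<longrightarrow> (\<forall>f\<in>test_functions {\<rho><..}.
       hardy_lhs {\<rho><..} m \<alpha> f \<ge>
       hardy_rhs {\<rho><..} m l N \<alpha> (\<lambda>p x. norm_ln p (\<tau> / x)) f)) \<and>
    (iter_exp N * \<rho> \<le> \<gamma> \<longrightarrow> (\<forall>f\<in>test_functions {0<..<\<rho>}.
       hardy_lhs {0<..<\<rho>} m \<alpha> f \<ge>
       hardy_rhs {0<..<\<rho>} m l N \<alpha> (\<lambda>p x. inverse (iter_ln p (\<gamma> / x))) f)) \<and>
    (\<rho> \<le> \<tau> \<longrightarrow> (\<forall>f\<in>test_functions {0<..<\<rho>}.
       hardy_lhs {0<..<\<rho>} m \<alpha> f \<ge>
       hardy_rhs {0<..<\<rho>} m l N \<alpha> (\<lambda>p x. norm_ln p (x / \<tau>)) f)) \<and>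
    (iter_exp N * \<gamma> \<le> \<rho> \<longrightarrow> (\<forall>f\<in>test_functions {\<rho><..}. (\<exists>x\<in>{\<rho><..}. f x \<noteq> 0) \<longrightarrow>
       hardy_lhs {\<rho><..} m \<alpha> f >
       hardy_rhs {\<rho><..} m l N \<alpha> (\<lambda>p x. inverse (iter_ln p (x / \<gamma>))) f)) \<and>
    (\<tau> \<le> \<rho> \<longrightarrow> (\<forall>f\<in>test_functions {\<rho><..}. (\<exists>x\<in>{\<rho><..}. f x \<noteq> 0) \<longrightarrow>
       hardy_lhs {\<rho><..} m \<alpha> f >
       hardy_rhs {\<rho><..} m l N \<alpha> (\<lambda>p x. norm_ln p (\<tau> / x)) f)) \<and>
    (iter_exp N * \<rho> \<le> \<gamma> \<longrightarrow> (\<forall>f\<in>test_functions {0<..<\<rho>}. (\<exists>x\<in>{0<..<\<rho>}. f x \<noteq> 0) \<longrightarrow>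
       hardy_lhs {0<..<\<rho>} m \<alpha> f >
       hardy_rhs {0<..<\<rho>} m l N \<alpha> (\<lambda>p x. inverse (iter_ln p (\<gamma> / x))) f)) \<and>
    (\<rho> \<le> \<tau> \<longrightarrow> (\<forall>f\<in>test_functions {0<..<\<rho>}. (\<exists>x\<in>{0<..<\<rho>}. f x \<noteq> 0) \<longrightarrow>
       hardy_lhs {0<..<\<rho>} m \<alpha> f >
       hardy_rhs {0<..<\<rho>} m l N \<alpha> (\<lambda>p x. norm_ln p (x / \<tau>)) f)) \<and>
    ((\<exists>j\<in>{1..l}. \<alpha> = 2 * real j - 1) \<longleftrightarrow> A_const l \<alpha> = 0) \<and>
    ((\<exists>j\<in>{1..l}. \<alpha> = 2 * real j - 1) \<longrightarrow>
      (iter_exp N * \<gamma> \<le> \<rho> \<longrightarrow> (\<forall>f\<in>test_functions {\<rho><..}.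
         hardy_lhs {\<rho><..} m \<alpha> f \<ge>
         hardy_rhs_exceptional {\<rho><..} m l N \<alpha> (\<lambda>p x. inverse (iter_ln p (x / \<gamma>))) f)) \<and>
      (\<tau> \<le> \<rho> \<longrightarrow> (\<forall>f\<in>test_functions {\<rho><..}.
         hardy_lhs {\<rho><..} m \<alpha> f \<ge>
         hardy_rhs_exceptional {\<rho><..} m l N \<alpha> (\<lambda>p x. norm_ln p (\<tau> / x)) f)) \<and>
      (iter_exp N * \<rho> \<le> \<gamma> \<longrightarrow> (\<forall>f\<in>test_functions {0<..<\<rho>}.
         hardy_lhs {0<..<\<rho>} m \<alpha> f \<ge>
         hardy_rhs_exceptional {0<..<\<rho>} m l N \<alpha> (\<lambda>p x. inverse (iter_ln p (\<gamma> / x))) f)) \<and>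
      (\<rho> \<le> \<tau> \<longrightarrow> (\<forall>f\<in>test_functions {0<..<\<rho>}.
         hardy_lhs {0<..<\<rho>} m \<alpha> f \<ge>
         hardy_rhs_exceptional {0<..<\<rho>} m l N \<alpha> (\<lambda>p x. norm_ln p (x / \<tau>)) f)) \<and>
      (iter_exp N * \<gamma> \<le> \<rho> \<longrightarrow> (\<forall>f\<in>test_functions {\<rho><..}. (\<exists>x\<in>{\<rho><..}. f x \<noteq> 0) \<longrightarrow>
         hardy_lhs {\<rho><..} m \<alpha> f >
         hardy_rhs_exceptional {\<rho><..} m l N \<alpha> (\<lambda>p x. inverse (iter_ln p (x / \<gamma>))) f)) \<and>
      (\<tau> \<le> \<rho> \<longrightarrow> (\<forall>f\<in>test_functions {\<rho><..}. (\<exists>x\<in>{\<rho><..}. f x \<noteq> 0) \<longrightarrow>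
         hardy_lhs {\<rho><..} m \<alpha> f >
         hardy_rhs_exceptional {\<rho><..} m l N \<alpha> (\<lambda>p x. norm_ln p (\<tau> / x)) f)) \<and>
      (iter_exp N * \<rho> \<le> \<gamma> \<longrightarrow> (\<forall>f\<in>test_functions {0<..<\<rho>}. (\<exists>x\<in>{0<..<\<rho>}. f x \<noteq> 0) \<longrightarrow>
         hardy_lhs {0<..<\<rho>} m \<alpha> f >
         hardy_rhs_exceptional {0<..<\<rho>} m l N \<alpha> (\<lambda>p x. inverse (iter_ln p (\<gamma> / x))) f)) \<and>
      (\<rho> \<le> \<tau> \<longrightarrow> (\<forall>f\<in>test_functions {0<..<\<rho>}. (\<exists>x\<in>{0<..<\<rho>}. f x \<noteq> 0) \<longrightarrow>
         hardy_lhs {0<..<\<rho>} m \<alpha> f >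
         hardy_rhs_exceptional {0<..<\<rho>} m l N \<alpha> (\<lambda>p x. norm_ln p (x / \<tau>)) f)))"
proof -
  \<comment> \<open>One logarithm is spent on the substitution, leaving n for the induction
    hypothesis.\<close>
  obtain n where N: "N = Suc n" using \<open>1 \<le> N\<close> by (cases N) auto
  have log_outer: "(\<forall>f\<in>test_functions {\<rho><..}. hardy_rhs {\<rho><..} m l N \<alpha> (\<lambda>p x. inverse (iter_ln p (x / \<gamma>))) f \<le> hardy_lhs {\<rho><..} m \<alpha> f) \<and>
      (\<forall>f\<in>test_functions {\<rho><..}. (\<exists>x\<in>{\<rho><..}. f x \<noteq> 0) \<longrightarrow>
        hardy_rhs {\<rho><..} m l N \<alpha> (\<lambda>p x. inverse (iter_ln p (x / \<gamma>))) f < hardy_lhs {\<rho><..} m \<alpha> f)"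
    if c: "iter_exp N * \<gamma> \<le> \<rho>"
    using hardy_strict_log_outer[OF log_hardy_iter_ln \<open>0 < \<gamma>\<close> c[unfolded N] \<open>1 \<le> l\<close>]
    unfolding N by (intro hardy_reduce[OF \<open>l \<le> m\<close>]) blast
  have norm_outer: "(\<forall>f\<in>test_functions {\<rho><..}. hardy_rhs {\<rho><..} m l N \<alpha> (\<lambda>p x. norm_ln p (\<tau> / x)) f \<le> hardy_lhs {\<rho><..} m \<alpha> f) \<and>
      (\<forall>f\<in>test_functions {\<rho><..}. (\<exists>x\<in>{\<rho><..}. f x \<noteq> 0) \<longrightarrow>
        hardy_rhs {\<rho><..} m l N \<alpha> (\<lambda>p x. norm_ln p (\<tau> / x)) f < hardy_lhs {\<rho><..} m \<alpha> f)"
    if c: "\<tau> \<le> \<rho>"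
    using hardy_strict_norm_outer[OF log_hardy_norm_ln \<open>0 < \<tau>\<close> c \<open>1 \<le> l\<close>]
    unfolding N by (intro hardy_reduce[OF \<open>l \<le> m\<close>]) blast
  have log_inner: "(\<forall>f\<in>test_functions {0<..<\<rho>}. hardy_rhs {0<..<\<rho>} m l N \<alpha> (\<lambda>p x. inverse (iter_ln p (\<gamma> / x))) f \<le> hardy_lhs {0<..<\<rho>} m \<alpha> f) \<and>
      (\<forall>f\<in>test_functions {0<..<\<rho>}. (\<exists>x\<in>{0<..<\<rho>}. f x \<noteq> 0) \<longrightarrow>
        hardy_rhs {0<..<\<rho>} m l N \<alpha> (\<lambda>p x. inverse (iter_ln p (\<gamma> / x))) f < hardy_lhs {0<..<\<rho>} m \<alpha> f)"
    if c: "iter_exp N * \<rho> \<le> \<gamma>"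
    using hardy_strict_log_inner[OF \<open>0 < \<gamma>\<close> \<open>0 < \<rho>\<close> c[unfolded N] \<open>1 \<le> l\<close>]
    unfolding N by (intro hardy_reduce[OF \<open>l \<le> m\<close>]) blast
  have norm_inner: "(\<forall>f\<in>test_functions {0<..<\<rho>}. hardy_rhs {0<..<\<rho>} m l N \<alpha> (\<lambda>p x. norm_ln p (x / \<tau>)) f \<le> hardy_lhs {0<..<\<rho>} m \<alpha> f) \<and>
      (\<forall>f\<in>test_functions {0<..<\<rho>}. (\<exists>x\<in>{0<..<\<rho>}. f x \<noteq> 0) \<longrightarrow>
        hardy_rhs {0<..<\<rho>} m l N \<alpha> (\<lambda>p x. norm_ln p (x / \<tau>)) f < hardy_lhs {0<..<\<rho>} m \<alpha> f)"
    if c: "\<rho> \<le> \<tau>"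
    using hardy_strict_norm_inner[OF \<open>0 < \<rho>\<close> c \<open>1 \<le> l\<close>]
    unfolding N by (intro hardy_reduce[OF \<open>l \<le> m\<close>]) blast
  note main = log_outer norm_outer log_inner norm_inner
  show ?thesis
    \<comment> \<open>Read as A(l, \<alpha>) = 0, the exceptional condition makes the two right-hand
      sides coincide.\<close>
    unfolding A_const_eq_0_iff
    by (intro conjI impI; (simp only: hardy_rhs_exceptional_eq)?;
        (rule main[THEN conjunct1] main[THEN conjunct2], assumption))
qed

end
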